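(* Let $H$ be a group and let $K$ be a semigroup. If the semigroups $\mathcal P(H)$ and $\mathcal P(K)$ are isomorphic, then $H$ and $K$ are isomorphic (as semigroups).
   Context: For a semigroup $S$, the large power semigroup $\mathcal P(S)$ is the semigroup whose elements are all non-empty subsets of $S$ (finite or infinite), with the operation of setwise multiplication $AB := \{ab : a \in A,\, b \in B\}$. All isomorphisms are semigroup isomorphisms. *)

theory Defs
  imports "HOL-Algebra.Coset"
begin

text \<open>
  A semigroup with an explicit carrier. HOL-Algebra provides no such locale, so we use its
  records \<open>monoid\<close> and impose nothing on the field \<open>one\<close>. The predicates \<open>hom\<close>, \<open>iso\<close> and
  \<open>\<cong>\<close> of HOL-Algebra do not refer to that field either: they are exactly semigroup
  homomorphisms and isomorphisms. The carrier may be empty.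
\<close>

locale carrier_semigroup =
  fixes S (structure)
  assumes m_closed: "\<lbrakk>x \<in> carrier S; y \<in> carrier S\<rbrakk> \<Longrightarrow> x \<otimes> y \<in> carrier S"
    and m_assoc: "\<lbrakk>x \<in> carrier S; y \<in> carrier S; z \<in> carrier S\<rbrakk>
      \<Longrightarrow> (x \<otimes> y) \<otimes> z = x \<otimes> (y \<otimes> z)"

text \<open>The field \<open>one\<close> below carries no information unless \<open>S\<close> is a monoid.\<close>

definition power_semigroup :: "('a, 'm) monoid_scheme \<Rightarrow> 'a set monoid"
  where "power_semigroup S =
    \<lparr>carrier = {A. A \<subseteq> carrier S \<and> A \<noteq> {}}, mult = set_mult S, one = {\<one>\<^bsub>S\<^esub>}\<rparr>"

lemma (in carrier_semigroup) carrier_semigroup_power_semigroup: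
  "carrier_semigroup (power_semigroup S)"
proof
  fix A B
  assume "A \<in> carrier (power_semigroup S)" "B \<in> carrier (power_semigroup S)"
  then show "A \<otimes>\<^bsub>power_semigroup S\<^esub> B \<in> carrier (power_semigroup S)"
    by (fastforce simp: power_semigroup_def set_mult_def intro: m_closed)
next
  fix A B C
  assume "A \<in> carrier (power_semigroup S)" "B \<in> carrier (power_semigroup S)"
    "C \<in> carrier (power_semigroup S)"
  then have "A \<subseteq> carrier S" "B \<subseteq> carrier S" "C \<subseteq> carrier S"
    by (auto simp: power_semigroup_def)
  then have "(a \<otimes> b) \<otimes> c = a \<otimes> (b \<otimes> c)" if "a \<in> A" "b \<in> B" "c \<in> C" for a b c
    using that m_assoc by blast
  then show "A \<otimes>\<^bsub>power_semigroup S\<^esub> B \<otimes>\<^bsub>power_semigroup S\<^esub> C =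
      A \<otimes>\<^bsub>power_semigroup S\<^esub> (B \<otimes>\<^bsub>power_semigroup S\<^esub> C)"
    by (simp add: power_semigroup_def set_mult_def)
qed

end

theory Submission
  imports Defs
begin

text \<open>
  An isomorphism \<open>f\<close> from \<open>\<P>(H)\<close> to \<open>\<P>(K)\<close> maps the unit \<open>{\<one>}\<close> to an identity of \<open>\<P>(K)\<close>,
  which must be \<open>{e}\<close> for an identity \<open>e\<close> of \<open>K\<close>. Hence \<open>f\<close> maps singletons, being invertible,
  to singletons: \<open>f {h} = {\<phi> h}\<close> for an injective homomorphism \<open>\<phi>\<close>. The set \<open>\<phi>(H)\<close> is invariant
  under multiplication by every \<open>\<phi> h\<close>, so its preimage under \<open>f\<close> is invariant under left
  translations and thus equals \<open>H\<close>, the zero of \<open>\<P>(H)\<close>. So \<open>\<phi>(H)\<close> is the zero of \<open>\<P>(K)\<close>;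
  as it contains \<open>e\<close>, it contains \<open>k \<cdot> e = k\<close> for every \<open>k\<close> in \<open>K\<close>.
\<close>

text \<open>Fix \<open>a\<close> in \<open>A\<close>. Any \<open>x\<close> is
  \<open>(x \<otimes> inv a) \<otimes> a\<close>, hence lies in the translate of \<open>A\<close> by
  \<open>x \<otimes> inv a\<close>, which is \<open>A\<close> again.\<close>

lemma (in group) left_translation_invariant_eq_carrier:
  assumes "A \<subseteq> carrier G" "A \<noteq> {}"
    and inv: "\<And>h. h \<in> carrier G \<Longrightarrow> {h} <#> A = A"
  shows "A = carrier G"
proof
  obtain a where a: "a \<in> A" "a \<in> carrier G" using assms by blast
  show "carrier G \<subseteq> A"
  proof
    fix x assume x: "x \<in> carrier G"
    then have "(x \<otimes> inv a) \<otimes> a \<in> {x \<otimes> inv a} <#> A"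
      using a by (auto simp: set_mult_def)
    with x a show "x \<in> A" using inv[of "x \<otimes> inv a"] by (simp add: m_assoc)
  qed
qed (fact assms(1))

text \<open>This absorption law is what \<open>f\<close> later transports to
  \<open>K\<close>.\<close>

lemma (in group) set_mult_carrier_right:
  assumes "B \<subseteq> carrier G" "B \<noteq> {}"
  shows "B <#> carrier G = carrier G"
proof
  obtain b where b: "b \<in> B" "b \<in> carrier G" using assms by blast
  show "carrier G \<subseteq> B <#> carrier G"
  proof
    fix x assume x: "x \<in> carrier G"
    then have "x = b \<otimes> (inv b \<otimes> x)" using b by (simp add: m_assoc[symmetric])
    then show "x \<in> B <#> carrier G"
      unfolding set_mult_def using b x by blast
  qed
qed (use assms in \<open>auto simp: set_mult_def\<close>)

text \<open>Testing on singletons makes each element of \<open>E\<close> a two-sided identity of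
  \<open>S\<close>, and two such elements \<open>a\<close>, \<open>e\<close> agree because
  \<open>a = a \<otimes> e = e\<close>.\<close>

lemma (in carrier_semigroup) power_semigroup_identity_singleton:
  assumes "E \<subseteq> carrier S" "E \<noteq> {}"
    and left: "\<And>x. x \<in> carrier S \<Longrightarrow> E <#> {x} = {x}"
    and right: "\<And>x. x \<in> carrier S \<Longrightarrow> {x} <#> E = {x}"
  obtains e where "E = {e}" "e \<in> carrier S"
    "\<And>x. x \<in> carrier S \<Longrightarrow> e \<otimes> x = x" "\<And>x. x \<in> carrier S \<Longrightarrow> x \<otimes> e = x"
proof -
  have l: "a \<otimes> x = x" if "a \<in> E" "x \<in> carrier S" for a x
    using left[OF that(2)] that(1) by (auto simp: set_mult_def)
  have r: "x \<otimes> a = x" if "a \<in> E" "x \<in> carrier S" for a x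
    using right[OF that(2)] that(1) by (auto simp: set_mult_def)
  obtain e where e: "e \<in> E" using assms(2) by blast
  have "a = e" if "a \<in> E" for a
    using l[OF that, of e] r[OF e, of a] subsetD[OF assms(1)] that e by simp
  then have "E = {e}" using e by blast
  with that e assms(1) l r show thesis by blast
qed

text \<open>All elements of \<open>A\<close> share an inverse \<open>b\<close> taken from
  \<open>B\<close>, so \<open>x = x \<otimes> (b \<otimes> a) = (x \<otimes> b) \<otimes> a =
  a\<close> for \<open>x\<close>, \<open>a\<close> in \<open>A\<close>.\<close>

lemma (in carrier_semigroup) power_semigroup_unit_singleton:
  assumes "A \<subseteq> carrier S" "A \<noteq> {}" "B \<subseteq> carrier S" "B \<noteq> {}"
    and "e \<in> carrier S"
    and l: "\<And>x. x \<in> carrier S \<Longrightarrow> e \<otimes> x = x" and r: "\<And>x. x \<in> carrier S \<Longrightarrow> x \<otimes> e = x"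
    and AB: "A <#> B = {e}" and BA: "B <#> A = {e}"
  obtains a where "a \<in> carrier S" "A = {a}"
proof -
  obtain a b where a: "a \<in> A" and b: "b \<in> B" using assms by blast
  have "x = a" if x: "x \<in> A" for x
  proof -
    have "b \<otimes> a = e" "x \<otimes> b = e"
      using AB BA a b x by (auto simp: set_mult_def)
    moreover have "(x \<otimes> b) \<otimes> a = x \<otimes> (b \<otimes> a)"
      using a b x assms by (intro m_assoc) auto
    ultimately have "e \<otimes> a = x \<otimes> e" by simp
    then show ?thesis using l[of a] r[of x] subsetD[OF assms(1)] a x by simp
  qed
  with a assms(1) that show thesis by blast
qed

theorem theorem1p3:
  fixes H :: "('a, 'm) monoid_scheme" and K :: "('b, 'n) monoid_scheme"
  assumes "group H" and "carrier_semigroup K"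
    and "power_semigroup H \<cong> power_semigroup K"
  shows "H \<cong> K"
proof -
  interpret H: group H by fact
  interpret K: carrier_semigroup K by fact
  obtain f where "f \<in> iso (power_semigroup H) (power_semigroup K)"
    using assms(3) by (auto simp: is_iso_def)
  then have f: "f \<in> hom (power_semigroup H) (power_semigroup K)"
    and bij: "bij_betw f {A. A \<subseteq> carrier H \<and> A \<noteq> {}} {A. A \<subseteq> carrier K \<and> A \<noteq> {}}"
    by (auto simp: iso_def power_semigroup_def)
  have mult: "f (A <#>\<^bsub>H\<^esub> B) = f A <#>\<^bsub>K\<^esub> f B"
    if "A \<subseteq> carrier H" "A \<noteq> {}" "B \<subseteq> carrier H" "B \<noteq> {}" for A B
    using f that by (auto simp: hom_def power_semigroup_def)
  have closed: "f A \<subseteq> carrier K" "f A \<noteq> {}" if "A \<subseteq> carrier H" "A \<noteq> {}" for A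
    using bij_betwE[OF bij] that by auto
  have surj: "\<exists>A. A \<subseteq> carrier H \<and> A \<noteq> {} \<and> f A = X" if "X \<subseteq> carrier K" "X \<noteq> {}" for X
  proof -
    have "X \<in> f ` {A. A \<subseteq> carrier H \<and> A \<noteq> {}}"
      using bij_betw_imp_surj_on[OF bij] that by simp
    then show ?thesis by blast
  qed
  have inj: "A = B" if "f A = f B" "A \<subseteq> carrier H" "A \<noteq> {}" "B \<subseteq> carrier H" "B \<noteq> {}" for A B
    by (rule inj_onD[OF bij_betw_imp_inj_on[OF bij]]) (use that in simp_all)

  \<comment> \<open>Surjectivity of \<open>f\<close> writes \<open>{x}\<close> as
    \<open>f A\<close>, so the identity laws for \<open>A\<close> carry over.\<close>
  have "f {\<one>\<^bsub>H\<^esub>} <#>\<^bsub>K\<^esub> {x} = {x} \<and> {x} <#>\<^bsub>K\<^esub> f {\<one>\<^bsub>H\<^esub>} = {x}" if "x \<in> carrier K" for x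
  proof -
    obtain A where A: "A \<subseteq> carrier H" "A \<noteq> {}" "f A = {x}"
      using surj[of "{x}"] \<open>x \<in> carrier K\<close> by auto
    have "{\<one>\<^bsub>H\<^esub>} <#>\<^bsub>H\<^esub> A = A" "A <#>\<^bsub>H\<^esub> {\<one>\<^bsub>H\<^esub>} = A"
      using A(1) by (force simp: set_mult_def)+
    then show ?thesis using mult[of "{\<one>\<^bsub>H\<^esub>}" A] mult[of A "{\<one>\<^bsub>H\<^esub>}"] A by simp
  qed
  moreover have "f {\<one>\<^bsub>H\<^esub>} \<subseteq> carrier K" "f {\<one>\<^bsub>H\<^esub>} \<noteq> {}"
    by (simp_all add: closed)
  ultimately obtain e where e: "f {\<one>\<^bsub>H\<^esub>} = {e}" "e \<in> carrier K"
      "\<And>x. x \<in> carrier K \<Longrightarrow> e \<otimes>\<^bsub>K\<^esub> x = x" "\<And>x. x \<in> carrier K \<Longrightarrow> x \<otimes>\<^bsub>K\<^esub> e = x"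
    using K.power_semigroup_identity_singleton[of "f {\<one>\<^bsub>H\<^esub>}"] by metis

  have "\<exists>y. y \<in> carrier K \<and> f {h} = {y}" if h: "h \<in> carrier H" for h
  proof -
    have "f {h} <#>\<^bsub>K\<^esub> f {inv\<^bsub>H\<^esub> h} = {e}" "f {inv\<^bsub>H\<^esub> h} <#>\<^bsub>K\<^esub> f {h} = {e}"
      using mult[of "{h}" "{inv\<^bsub>H\<^esub> h}"] mult[of "{inv\<^bsub>H\<^esub> h}" "{h}"] h e(1)
      by (simp_all add: set_mult_def)
    moreover have "f {h} \<subseteq> carrier K" "f {h} \<noteq> {}"
      "f {inv\<^bsub>H\<^esub> h} \<subseteq> carrier K" "f {inv\<^bsub>H\<^esub> h} \<noteq> {}"
      using h by (simp_all add: closed)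
    ultimately obtain y where "y \<in> carrier K" "f {h} = {y}"
      using K.power_semigroup_unit_singleton[of "f {h}" "f {inv\<^bsub>H\<^esub> h}" e] e(2-4) by metis
    then show ?thesis by blast
  qed
  then obtain \<phi> where \<phi>: "\<And>h. h \<in> carrier H \<Longrightarrow> \<phi> h \<in> carrier K \<and> f {h} = {\<phi> h}" by metis
  have \<phi>_mult: "\<phi> (x \<otimes>\<^bsub>H\<^esub> y) = \<phi> x \<otimes>\<^bsub>K\<^esub> \<phi> y" if "x \<in> carrier H" "y \<in> carrier H" for x y
    using mult[of "{x}" "{y}"] that \<phi>[of x] \<phi>[of y] \<phi>[of "x \<otimes>\<^bsub>H\<^esub> y"]
    by (simp add: set_mult_def)
  have \<phi>_inj: "inj_on \<phi> (carrier H)"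
  proof (rule inj_onI)
    fix x y assume "x \<in> carrier H" "y \<in> carrier H" "\<phi> x = \<phi> y"
    then show "x = y" using inj[of "{x}" "{y}"] \<phi> by simp
  qed

  let ?U = "\<phi> ` carrier H"
  have U: "?U \<subseteq> carrier K" "?U \<noteq> {}" using \<phi> by auto
  \<comment> \<open>Nothing so far says that \<open>f\<close> acts on larger sets as the image under
    \<open>\<phi>\<close>, so the preimage of \<open>?U\<close> has to be identified by other
    means.\<close>
  obtain A where A: "A \<subseteq> carrier H" "A \<noteq> {}" "f A = ?U" using surj[OF U] by blast
  have "{h} <#>\<^bsub>H\<^esub> A = A" if h: "h \<in> carrier H" for h
  \<comment> \<open>Both sides have the image \<open>?U\<close> under \<open>f\<close>, since left
    multiplication by \<open>\<phi> h\<close> permutes \<open>?U\<close>.\<close>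
  proof (rule inj)
    have "f ({h} <#>\<^bsub>H\<^esub> A) = {\<phi> h} <#>\<^bsub>K\<^esub> ?U" using mult[of "{h}" A] h A \<phi> by simp
    also have "\<dots> = \<phi> ` ({h} <#>\<^bsub>H\<^esub> carrier H)"
      using \<phi>_mult h by (force simp: set_mult_def)
    also have "{h} <#>\<^bsub>H\<^esub> carrier H = carrier H" using H.set_mult_carrier_right h by simp
    finally show "f ({h} <#>\<^bsub>H\<^esub> A) = f A" using A by simp
  qed (use A h in \<open>auto simp: set_mult_def\<close>)
  then have "A = carrier H" using A H.left_translation_invariant_eq_carrier by blast
  then have fH: "f (carrier H) = ?U" using A by simp

  have "k \<in> ?U" if k: "k \<in> carrier K" for k
  proof -
    obtain B where B: "B \<subseteq> carrier H" "B \<noteq> {}" "f B = {k}" using surj[of "{k}"] k by auto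
    \<comment> \<open>Absorption \<open>B <#> carrier H = carrier H\<close> is mapped by
      \<open>f\<close> to this equation, even though \<open>B\<close> need not be known to be a
      singleton.\<close>
    have "{k} <#>\<^bsub>K\<^esub> ?U = ?U"
      using mult[of B "carrier H"] B fH H.set_mult_carrier_right[of B] by auto
    \<comment> \<open>Here \<open>e\<close> is \<open>\<phi>\<close> of the unit of
      \<open>H\<close>.\<close>
    moreover have "e \<in> ?U" using \<phi>[of "\<one>\<^bsub>H\<^esub>"] e(1) by force
    then have "k \<otimes>\<^bsub>K\<^esub> e \<in> {k} <#>\<^bsub>K\<^esub> ?U" by (auto simp: set_mult_def)
    ultimately show ?thesis using e(4) k by simp
  qed
  with U(1) have "bij_betw \<phi> (carrier H) (carrier K)" using \<phi>_inj by (auto simp: bij_betw_def)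
  then have "\<phi> \<in> iso H K" using \<phi> \<phi>_mult by (auto simp: iso_def hom_def)
  then show ?thesis by (auto simp: is_iso_def)
qed

end
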